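(* Let $N\ge 2$, $2\le p<N$, $r_0>0$, $\lambda\in[0,C_H]$ where $C_H=\left|\frac{p-N}{p}\right|^p$, and consider the equation $$-\Delta_p u-\frac{\lambda}{|x|^p}|u|^{p-2}u=0\quad\text{in }B]r_0,\infty[.$$ Let $\alpha_\lambda\le\bar\alpha_\lambda$ be the roots in $\left[\frac{p-N}{p-1},0\right]$ of $\alpha|\alpha|^{p-2}\big(p-N-(p-1)\alpha\big)=\lambda$. Then: (a) for every positive (not necessarily radial or decreasing) $C^2$-supersolution $w$ of the equation there is $C>0$ with $|x|^{\alpha_\lambda}\le C\,w(x)$ for all $x\in B[r_0,\infty[$; (b) for every positive radial strictly monotone decreasing $C^2$-supersolution $v$ of the equation: if $\lambda<C_H$ then $\displaystyle\limsup_{|x|\to\infty}\frac{|x|^{\bar\alpha_\lambda}}{v(x)}>0$, while if $\lambda=C_H$ then for every $\tau>0$ $$\limsup_{|x|\to\infty}\frac{|x|^{\frac{p-N}{p}}(\log|x|)^{2/p}(\log\log|x|)^\tau}{v(x)}>0.$$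
   Context: $\Delta_p u=\nabla\cdot(|\nabla u|^{p-2}\nabla u)$. $B]r_0,\infty[=\{x\in\mathbb{R}^N:|x|>r_0\}$, $B[r_0,\infty[=\{x:|x|\ge r_0\}$. A $C^2$-supersolution is a function $w\in C^2(B[r_0,\infty[)$ with $-\Delta_p w-\lambda|x|^{-p}|w|^{p-2}w\ge 0$ pointwise in $B]r_0,\infty[$. A radial function $v(x)=\phi(|x|)$ is strictly monotone decreasing if $\phi'(r)<0$ for all $r\ge r_0$. (For $0<\lambda<C_H$ there are exactly two such roots, for $\lambda=C_H$ they coincide and equal $\frac{p-N}{p}$, and for $\lambda=0$ they are $\frac{p-N}{p-1}$ and $0$.) *)

theory Defs
  imports "HOL-Analysis.Analysis"
begin

definition grad :: "('a::euclidean_space \<Rightarrow> real) \<Rightarrow> 'a \<Rightarrow> 'a" where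
  "grad w x = (\<Sum>b\<in>Basis. frechet_derivative w (at x) b *\<^sub>R b)"

definition C2_on :: "'a::euclidean_space set \<Rightarrow> ('a \<Rightarrow> real) \<Rightarrow> bool" where
  "C2_on U w \<longleftrightarrow>
     (\<forall>x\<in>U. w differentiable (at x)) \<and>
     (\<forall>x\<in>U. grad w differentiable (at x)) \<and>
     (\<forall>i\<in>Basis. \<forall>j\<in>Basis. continuous_on U (\<lambda>x. frechet_derivative (grad w) (at x) i \<bullet> j))"

definition plap :: "real \<Rightarrow> ('a::euclidean_space \<Rightarrow> real) \<Rightarrow> 'a \<Rightarrow> real" where
  "plap p w x = (\<Sum>b\<in>Basis.
      frechet_derivative (\<lambda>y. (norm (grad w y) powr (p - 2)) *\<^sub>R grad w y) (at x) b \<bullet> b)"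

text \<open>C^2-supersolution of -Delta_p u - lam |x|^(-p) |u|^(p-2) u = 0 in B]r0,inf[,
  with w in C^2(B[r0,inf[) (C^2 on an open neighbourhood of the closed exterior).\<close>
definition C2_supersol :: "real \<Rightarrow> real \<Rightarrow> real \<Rightarrow> ('a::euclidean_space \<Rightarrow> real) \<Rightarrow> bool" where
  "C2_supersol p lam r0 w \<longleftrightarrow>
     (\<exists>U. open U \<and> {x. norm x \<ge> r0} \<subseteq> U \<and> C2_on U w) \<and>
     (\<forall>x. norm x > r0 \<longrightarrow>
        - plap p w x - lam / (norm x powr p) * (\<bar>w x\<bar> powr (p - 2)) * w x \<ge> 0)"

end

theory Submission
  imports Defs "HOL-Real_Asymp.Real_Asymp"
begin

text \<open>
  Write \<open>y = - r f' / f\<close> and \<open>n = N\<close>. For a positive decreasing radial function \<open>f\<close> the equation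
  becomes the Riccati equation \<open>(p - 1) r y' = (p - 1) y\<^sup>2 - (n - p) y + \<lambda> y\<^sup>2\<^sup>-\<^sup>p\<close>, with \<open>\<ge>\<close> for
  supersolutions, and the roots \<open>\<alpha>\<close> are minus its stationary points \<open>\<beta>\<close>. Convexity of
  \<open>y\<^sup>2\<^sup>-\<^sup>p\<close> at \<open>\<beta>\<close> bounds the right-hand side below by \<open>p - 1\<close> times
  \<open>(y - \<beta>)\<^sup>2 - (n - p - p \<beta>) (y - \<beta>)\<close>.

  (a) For the larger \<open>\<beta>\<close> this shows that \<open>f = r\<^sup>-\<^sup>\<beta> (ln R - ln r)\<^sup>2\<close> is a strict subsolution on
  \<open>r < R\<close>. The quotient \<open>f / w\<close> attains its maximum over the annulus \<open>r0 \<le> |x| \<le> R\<close>; at an interior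
  maximum a multiple of \<open>f\<close> touches \<open>w\<close> from below, where ellipticity gives a contradiction. So the
  maximum lies on \<open>|x| = r0\<close>, and \<open>R \<rightarrow> \<infinity>\<close> gives the bound.

  (b) For the smaller \<open>\<beta>\<close> put \<open>u = y - \<beta>\<close>. If \<open>\<kappa> = n - p - p \<beta> > 0\<close> then \<open>r u' \<ge> - \<kappa> u\<close>, so the negative
  part of \<open>u\<close> is \<open>O(r\<^sup>-\<^sup>\<kappa>)\<close> and integrating \<open>(ln (r\<^sup>\<beta> f))' = - u / r\<close> bounds \<open>r\<^sup>\<beta> f\<close>. If \<open>\<kappa> = 0\<close> then \<open>u\<close> is
  nondecreasing and \<open>r u' \<ge> (p / 2) u\<^sup>2\<close> while \<open>u < 0\<close>, so \<open>- u \<le> (2 / p) / (ln r - ln r1)\<close> and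
  \<open>r\<^sup>\<beta> f = O((ln r)\<^sup>2\<^sup>/\<^sup>p)\<close>.
\<close>

section \<open>The p-Laplacian of radial functions and touching from below\<close>

lemma grad_eqI:
  fixes w :: "'a::euclidean_space \<Rightarrow> real"
  assumes "(w has_derivative (\<lambda>h. g \<bullet> h)) (at x)"
  shows "grad w x = g"
proof -
  have "frechet_derivative w (at x) = (\<lambda>h. g \<bullet> h)"
    using frechet_derivative_at[OF assms] by simp
  then show ?thesis
    by (simp add: grad_def euclidean_representation)
qed

lemma has_derivative_grad:
  fixes w :: "'a::euclidean_space \<Rightarrow> real"
  assumes "w differentiable (at x)"
  shows "(w has_derivative (\<lambda>h. grad w x \<bullet> h)) (at x)"
proof -
  let ?D = "frechet_derivative w (at x)"
  have D: "(w has_derivative ?D) (at x)"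
    using assms frechet_derivative_works by blast
  then interpret linear ?D by (rule has_derivative_linear)
  have "?D h = grad w x \<bullet> h" for h
  proof -
    have "?D h = ?D (\<Sum>b\<in>Basis. (h \<bullet> b) *\<^sub>R b)" by (simp add: euclidean_representation)
    also have "\<dots> = (\<Sum>b\<in>Basis. (h \<bullet> b) *\<^sub>R ?D b)" by (simp add: sum scale)
    also have "\<dots> = grad w x \<bullet> h"
      by (simp add: grad_def inner_sum_right mult.commute inner_commute)
    finally show ?thesis .
  qed
  then show ?thesis using D by (metis (no_types, lifting) ext)
qed

text \<open>Product rule, with a nonvanishing gradient making \<open>norm\<close> differentiable
  there. For fixed gradient and \<open>p \<ge> 2\<close> the result is monotone in the quadratic
  form of \<open>H\<close>, which is the ellipticity used below.\<close>

lemma plap_eq: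
  fixes w :: "'a::euclidean_space \<Rightarrow> real"
  assumes H: "(grad w has_derivative H) (at x)" and nz: "grad w x \<noteq> 0"
  shows "plap p w x = norm (grad w x) powr (p - 2) *
    ((\<Sum>b\<in>Basis. H b \<bullet> b) + (p - 2) * (H (grad w x) \<bullet> grad w x) / (norm (grad w x))\<^sup>2)"
proof -
  define G where "G = grad w x"
  define n where "n = norm G"
  have n: "n > 0" using nz by (simp add: n_def G_def)
  have dn: "((\<lambda>y. norm (grad w y)) has_derivative (\<lambda>h. H h \<bullet> sgn G)) (at x)"
    unfolding G_def
    using has_derivative_compose[OF H has_derivative_norm[OF nz]] by simp
  have dp: "((\<lambda>y. norm (grad w y) powr (p - 2)) has_derivative
      (\<lambda>h. n powr (p - 2) * ((H h \<bullet> sgn G) * (p - 2) / n))) (at x)"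
    using has_derivative_powr[OF dn has_derivative_const[of "p - 2"]] n
    by (simp add: n_def G_def)
  have dX: "((\<lambda>y. norm (grad w y) powr (p - 2) *\<^sub>R grad w y) has_derivative
      (\<lambda>h. n powr (p - 2) *\<^sub>R H h + (n powr (p - 2) * ((H h \<bullet> sgn G) * (p - 2) / n)) *\<^sub>R G)) (at x)"
    using has_derivative_scaleR[OF dp H] by (simp add: n_def G_def)
  interpret linear H using H by (rule has_derivative_linear)
  have HG: "(\<Sum>b\<in>Basis. (H b \<bullet> G) * (G \<bullet> b)) = H G \<bullet> G"
  proof -
    have "H G = H (\<Sum>b\<in>Basis. (G \<bullet> b) *\<^sub>R b)" by (simp add: euclidean_representation)
    also have "\<dots> = (\<Sum>b\<in>Basis. (G \<bullet> b) *\<^sub>R H b)" by (simp add: sum scale)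
    finally show ?thesis by (simp add: inner_sum_left mult.commute)
  qed
  have "plap p w x = (\<Sum>b\<in>Basis. n powr (p - 2) * (H b \<bullet> b)
      + n powr (p - 2) * (p - 2) / n\<^sup>2 * ((H b \<bullet> G) * (G \<bullet> b)))"
    unfolding plap_def frechet_derivative_at[OF dX, symmetric]
    by (intro sum.cong refl)
       (simp add: inner_add_left sgn_div_norm n_def power2_eq_square divide_simps)
  also have "\<dots> = n powr (p - 2) * (\<Sum>b\<in>Basis. H b \<bullet> b)
      + n powr (p - 2) * (p - 2) / n\<^sup>2 * (H G \<bullet> G)"
    unfolding sum.distrib sum_distrib_left[symmetric] HG ..
  finally show ?thesis by (simp add: n_def G_def algebra_simps)
qed

section \<open>Second-order comparison at a touching point\<close>

text \<open>On the line through \<open>x\<close> in direction \<open>e\<close>, a negative second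
  derivative would make the slope, zero at \<open>x\<close>, negative for small
  \<open>t > 0\<close>; the mean value theorem then gives a value of \<open>h\<close> below
  \<open>h x\<close>.\<close>

lemma local_min_second_derivative:
  fixes h :: "'a::euclidean_space \<Rightarrow> real"
  assumes S: "open S" "x \<in> S"
    and min: "\<And>y. y \<in> S \<Longrightarrow> h x \<le> h y"
    and g: "\<And>y. y \<in> S \<Longrightarrow> (h has_derivative (\<lambda>v. g y \<bullet> v)) (at y)"
    and D: "(g has_derivative D) (at x)"
  shows "g x = 0" and "D e \<bullet> e \<ge> 0"
proof -
  have "(\<lambda>v. g x \<bullet> v) = (\<lambda>v. 0)"
    using differential_zero_maxmin[OF S(2,1) g[OF S(2)]] min by auto
  then have "g x \<bullet> g x = 0" by metis
  then show gx: "g x = 0" by simp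
  show "D e \<bullet> e \<ge> 0"
  proof (rule ccontr)
    assume "\<not> D e \<bullet> e \<ge> 0"
    then have De: "D e \<bullet> e < 0" by simp
    let ?l = "\<lambda>t::real. x + t *\<^sub>R e"
    interpret linear D using D by (rule has_derivative_linear)
    have dl: "(?l has_derivative (\<lambda>t. t *\<^sub>R e)) (at t)" for t
      by (auto intro!: derivative_eq_intros)
    have "((\<lambda>t. g (?l t) \<bullet> e) has_derivative (\<lambda>t. D (t *\<^sub>R e) \<bullet> e)) (at 0)"
      by (rule has_derivative_inner_left, rule has_derivative_compose[OF dl]) (simp add: D)
    then have "((\<lambda>t. g (?l t) \<bullet> e) has_real_derivative (D e \<bullet> e)) (at 0)"
      unfolding has_field_derivative_def by (simp add: scale mult_commute_abs)
    from has_real_derivative_neg_dec_right[OF this De]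
    obtain d where d: "d > 0" "\<And>t. 0 < t \<Longrightarrow> t < d \<Longrightarrow> g (?l t) \<bullet> e < 0"
      using gx by auto
    have "open (?l -` S)"
      using S(1) by (intro continuous_open_vimage) (auto intro!: continuous_intros)
    moreover have "0 \<in> ?l -` S" using S(2) by simp
    ultimately obtain d' where d': "d' > 0" "ball 0 d' \<subseteq> ?l -` S"
      using open_contains_ball_eq by blast
    define t where "t = min d d' / 2"
    have t: "0 < t" "t < d" "t < d'" using d(1) d'(1) by (auto simp: t_def)
    have inS: "?l s \<in> S" if "0 \<le> s" "s \<le> t" for s
    proof -
      have "s \<in> ball 0 d'" using that t by (simp add: dist_norm)
      then show ?thesis using d'(2) by auto
    qed
    have dh: "((\<lambda>t. h (?l t)) has_real_derivative (g (?l s) \<bullet> e)) (at s)"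
      if "0 \<le> s" "s \<le> t" for s
      using has_derivative_compose[OF dl g[OF inS[OF that]]]
      by (simp add: has_field_derivative_def mult_commute_abs)
    obtain s where s: "0 < s" "s < t" "h (?l t) - h (?l 0) = (t - 0) * (g (?l s) \<bullet> e)"
      using MVT2[OF t(1), of "\<lambda>t. h (?l t)" "\<lambda>s. g (?l s) \<bullet> e"] dh by auto
    have "h (?l t) < h x"
      using s d(2)[of s] t mult_pos_neg[of t "g (?l s) \<bullet> e"] by simp
    moreover have "h x \<le> h (?l t)" using min inS[of t] t by simp
    ultimately show False by simp
  qed
qed

text \<open>The second-derivative test for \<open>w - f\<close> equates the gradients at
  \<open>x\<close> and orders the Hessian forms in every direction; \<open>plap_eq\<close> then
  compares term by term.\<close>

lemma plap_mono_touching: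
  fixes w f :: "'a::euclidean_space \<Rightarrow> real"
  assumes p: "2 \<le> p" and S: "open S" "x \<in> S"
    and touch: "f x = w x" "\<And>y. y \<in> S \<Longrightarrow> f y \<le> w y"
    and w: "\<And>y. y \<in> S \<Longrightarrow> w differentiable (at y)" "grad w differentiable (at x)"
    and f: "\<And>y. y \<in> S \<Longrightarrow> f differentiable (at y)" "grad f differentiable (at x)"
    and nz: "grad f x \<noteq> 0"
  shows "plap p f x \<le> plap p w x"
proof -
  obtain Hw where Hw: "(grad w has_derivative Hw) (at x)"
    using w(2) by (auto simp: differentiable_def)
  obtain Hf where Hf: "(grad f has_derivative Hf) (at x)"
    using f(2) by (auto simp: differentiable_def)
  have d1: "((\<lambda>y. w y - f y) has_derivative (\<lambda>v. (grad w y - grad f y) \<bullet> v)) (at y)"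
    if "y \<in> S" for y
    using has_derivative_diff[OF has_derivative_grad[OF w(1)[OF that]] has_derivative_grad[OF f(1)[OF that]]]
    by (simp add: inner_diff_left)
  have d2: "((\<lambda>y. grad w y - grad f y) has_derivative (\<lambda>v. Hw v - Hf v)) (at x)"
    using has_derivative_diff[OF Hw Hf] .
  note loc = local_min_second_derivative[OF S _ d1 d2]
  have G: "grad w x = grad f x" using loc(1) touch by fastforce
  have le: "Hf e \<bullet> e \<le> Hw e \<bullet> e" for e
    using loc(2)[of e] touch by (fastforce simp: inner_diff_left)
  show ?thesis
    unfolding plap_eq[OF Hf nz] plap_eq[OF Hw nz[folded G]] G using p
    by (intro mult_left_mono add_mono sum_mono divide_right_mono le) auto
qed

section \<open>Radial functions\<close>

text \<open>Chain rule through \<open>norm\<close>, hence away from the origin. The derivative of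
  the gradient multiplies \<open>x\<close> by \<open>F2\<close> and vectors orthogonal to
  \<open>x\<close> by \<open>F' (norm x) / norm x\<close>.\<close>

lemma radial_derivatives:
  fixes f :: "'a::euclidean_space \<Rightarrow> real"
  assumes S: "open S" "x \<in> S" "0 \<notin> S"
    and f: "\<And>y. y \<in> S \<Longrightarrow> f y = F (norm y)"
    and F: "\<And>y. y \<in> S \<Longrightarrow> (F has_real_derivative F' (norm y)) (at (norm y))"
    and F': "(F' has_real_derivative F2) (at (norm x))"
  shows "y \<in> S \<Longrightarrow> (f has_derivative (\<lambda>h. ((F' (norm y) / norm y) *\<^sub>R y) \<bullet> h)) (at y)"
    and "(grad f has_derivative (\<lambda>h. (F' (norm x) / norm x) *\<^sub>R h +
           ((F2 - F' (norm x) / norm x) / (norm x)\<^sup>2 * (x \<bullet> h)) *\<^sub>R x)) (at x)"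
proof -
  show d: "(f has_derivative (\<lambda>h. ((F' (norm y) / norm y) *\<^sub>R y) \<bullet> h)) (at y)" if y: "y \<in> S" for y
  proof (rule has_derivative_transform_within_open[OF _ S(1) y])
    have "y \<noteq> 0" using y S by auto
    from has_derivative_compose[OF has_derivative_norm[OF this] F[OF y, unfolded has_field_derivative_def]]
    show "((\<lambda>y. F (norm y)) has_derivative (\<lambda>h. ((F' (norm y) / norm y) *\<^sub>R y) \<bullet> h)) (at y)"
      by (simp add: sgn_div_norm inner_commute divide_inverse ac_simps)
  qed (simp add: f)
  have x: "x \<noteq> 0" using S by auto
  have "((\<lambda>r. F' r / r) has_real_derivative (F2 - F' (norm x) / norm x) / norm x) (at (norm x))"
    using x by (auto intro!: derivative_eq_intros F' simp: field_simps)
  from has_derivative_scaleR[OF has_derivative_compose[OF has_derivative_norm[OF x]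
      this[unfolded has_field_derivative_def]] has_derivative_ident]
  have "((\<lambda>y. (F' (norm y) / norm y) *\<^sub>R y) has_derivative (\<lambda>h. (F' (norm x) / norm x) *\<^sub>R h +
           ((F2 - F' (norm x) / norm x) / (norm x)\<^sup>2 * (x \<bullet> h)) *\<^sub>R x)) (at x)"
    by (simp add: sgn_div_norm inner_commute divide_inverse ac_simps power2_eq_square)
  then show "(grad f has_derivative (\<lambda>h. (F' (norm x) / norm x) *\<^sub>R h +
           ((F2 - F' (norm x) / norm x) / (norm x)\<^sup>2 * (x \<bullet> h)) *\<^sub>R x)) (at x)"
    by (rule has_derivative_transform_within_open[OF _ S(1,2)]) (simp add: grad_eqI[OF d])
qed

text \<open>The trace in \<open>plap_eq\<close> is \<open>F2\<close> plus \<open>DIM('a) - 1\<close>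
  copies of \<open>F' r / r\<close>; the gradient is radial, so the other term adds
  \<open>(p - 2) * F2\<close>.\<close>

lemma plap_radial:
  fixes f :: "'a::euclidean_space \<Rightarrow> real"
  assumes S: "open S" "x \<in> S" "0 \<notin> S"
    and f: "\<And>y. y \<in> S \<Longrightarrow> f y = F (norm y)"
    and F: "\<And>y. y \<in> S \<Longrightarrow> (F has_real_derivative F' (norm y)) (at (norm y))"
    and F': "(F' has_real_derivative F2) (at (norm x))"
    and nz: "F' (norm x) \<noteq> 0"
  shows "plap p f x = \<bar>F' (norm x)\<bar> powr (p - 2) *
    ((p - 1) * F2 + (real DIM('a) - 1) * F' (norm x) / norm x)"
proof -
  define r where "r = norm x"
  have x: "x \<noteq> 0" using S by auto
  then have r: "r > 0" by (simp add: r_def)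
  have xx: "x \<bullet> x = r\<^sup>2" by (simp add: r_def power2_norm_eq_inner)
  have "(f has_derivative (\<lambda>h. ((F' r / r) *\<^sub>R x) \<bullet> h)) (at x)"
    unfolding r_def using radial_derivatives(1)[OF S f F F' S(2)] by blast
  then have G: "grad f x = (F' r / r) *\<^sub>R x" by (rule grad_eqI)
  have H: "(grad f has_derivative (\<lambda>h. (F' r / r) *\<^sub>R h +
      ((F2 - F' r / r) / r\<^sup>2 * (x \<bullet> h)) *\<^sub>R x)) (at x)"
    unfolding r_def using radial_derivatives(2)[OF S f F F'] by blast
  have nG: "norm (grad f x) = \<bar>F' r\<bar>" using r by (simp add: G r_def)
  have tr: "(\<Sum>b\<in>Basis. (x \<bullet> b) * (x \<bullet> b)) = r\<^sup>2"
    using xx euclidean_inner[of x x] by simp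
  have "(\<Sum>b\<in>Basis. ((F' r / r) *\<^sub>R b + ((F2 - F' r / r) / r\<^sup>2 * (x \<bullet> b)) *\<^sub>R x) \<bullet> b)
    = (\<Sum>b\<in>(Basis::'a set). F' r / r) + (\<Sum>b\<in>Basis. (F2 - F' r / r) / r\<^sup>2 * ((x \<bullet> b) * (x \<bullet> b)))"
    unfolding sum.distrib[symmetric]
    by (intro sum.cong refl) (simp add: inner_add_left)
  also have "\<dots> = real DIM('a) * (F' r / r) + (F2 - F' r / r)"
    unfolding sum_distrib_left[symmetric] tr using r by simp
  also have "\<dots> = F2 + (real DIM('a) - 1) * F' r / r"
    by (simp add: algebra_simps diff_divide_distrib)
  finally have T: "(\<Sum>b\<in>Basis. ((F' r / r) *\<^sub>R b + ((F2 - F' r / r) / r\<^sup>2 * (x \<bullet> b)) *\<^sub>R x) \<bullet> b)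
    = F2 + (real DIM('a) - 1) * F' r / r" .
  have Q: "((F' r / r) *\<^sub>R grad f x + ((F2 - F' r / r) / r\<^sup>2 * (x \<bullet> grad f x)) *\<^sub>R x) \<bullet> grad f x
    = F2 * (F' r)\<^sup>2"
    using r unfolding G by (simp add: inner_add_left xx field_simps power2_eq_square)
  have "grad f x \<noteq> 0" using nG nz by (auto simp: r_def)
  have Z: "(p - 2) * (F2 * (F' r)\<^sup>2) / \<bar>F' r\<bar>\<^sup>2 = (p - 2) * F2"
    using nz by (simp add: r_def)
  show ?thesis
    unfolding plap_eq[OF H \<open>grad f x \<noteq> 0\<close>] nG T Q Z r_def[symmetric]
    by (simp add: algebra_simps)
qed

section \<open>The Riccati inequality\<close>

text \<open>Substituting \<open>F1\<close> extracts a positive factor, so the sign of the residual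
  of the equation is that of the Riccati bracket. For the zero-order term this rests on the
  homogeneity identity proved first.\<close>

lemma radial_residual:
  fixes F F1 F2 r y p n lam :: real
  assumes pos: "F > 0" "y > 0" "r > 0" and F1: "F1 = - (F * y / r)"
  shows "\<bar>F1\<bar> powr (p - 2) * ((p - 1) * F2 + (n - 1) * F1 / r) + lam / r powr p * \<bar>F\<bar> powr (p - 2) * F
    = F * \<bar>F1\<bar> powr (p - 2) / r\<^sup>2 * ((p - 1) * (r\<^sup>2 * F2 / F) - (n - 1) * y + lam * y powr (2 - p))"
proof -
  define A where "A = \<bar>F1\<bar> powr (p - 2)"
  have "A * y powr (2 - p) * r powr p = F powr (p - 2) * r\<^sup>2"
  proof -
    have "A = F powr (p - 2) * y powr (p - 2) / r powr (p - 2)"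
      using pos by (simp add: A_def F1 powr_divide powr_mult)
    moreover have "y powr (p - 2) * y powr (2 - p) = 1"
      using pos by (simp add: powr_add[symmetric])
    moreover have "r powr p = r powr (p - 2) * r\<^sup>2"
      using pos by (simp add: powr_diff powr_numeral)
    moreover have "A * r powr (p - 2) * y powr (2 - p) = F powr (p - 2)" if
      "A = F powr (p - 2) * y powr (p - 2) / r powr (p - 2)" "y powr (p - 2) * y powr (2 - p) = 1"
      unfolding that(1) using that(2) pos by (simp add: mult.assoc)
    ultimately show ?thesis by (simp add: ac_simps)
  qed
  then have "lam / r powr p * F powr (p - 2) * F = F * A / r\<^sup>2 * (lam * y powr (2 - p))"
    using pos by (simp add: field_simps)
  moreover have "A * ((p - 1) * F2 + (n - 1) * F1 / r)
    = F * A / r\<^sup>2 * ((p - 1) * (r\<^sup>2 * F2 / F) - (n - 1) * y)"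
    using pos by (simp add: F1 field_simps power2_eq_square)
  ultimately show ?thesis using pos by (simp add: A_def algebra_simps)
qed

section \<open>Lower bounds for the Riccati right-hand side\<close>

text \<open>Multiply \<open>ln t \<le> t - 1\<close> by the nonpositive \<open>2 - p\<close>, then
  apply \<open>exp s \<ge> 1 + s\<close>.\<close>

lemma powr_ge_tangent:
  fixes t p :: real
  assumes "t > 0" "p \<ge> 2"
  shows "1 + (2 - p) * (t - 1) \<le> t powr (2 - p)"
proof -
  have "(2 - p) * (t - 1) \<le> (2 - p) * ln t"
    using assms ln_le_minus_one[of t] by (intro mult_left_mono_neg) auto
  also have "1 + (2 - p) * ln t \<le> exp ((2 - p) * ln t)" by (rule exp_ge_add_one_self)
  finally show ?thesis using assms by (simp add: powr_def)
qed

text \<open>The gap \<open>?D\<close> vanishes at 1, and its derivative is \<open>p - 2\<close>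
  times the gap in \<open>powr_ge_tangent\<close> with \<open>p + 1\<close> in place of
  \<open>p\<close>, hence nonnegative.\<close>

lemma powr_ge_parabola:
  fixes t p :: real
  assumes t: "0 < t" "t \<le> 1" and p: "p \<ge> 2"
  shows "1 + (p - 2) * (1 - t) + (p - 2) * (p - 1) / 2 * (1 - t)\<^sup>2 \<le> t powr (2 - p)"
proof -
  let ?D = "\<lambda>t::real. 1 + (p - 2) * (1 - t) + (p - 2) * (p - 1) / 2 * (1 - t)\<^sup>2 - t powr (2 - p)"
  have "?D t \<le> ?D 1"
  proof (rule DERIV_nonneg_imp_nondecreasing[OF t(2)])
    fix s assume s: "t \<le> s" "s \<le> 1"
    then have s0: "s > 0" using t by simp
    have "(?D has_real_derivative (p - 2) * (s powr (2 - (p + 1)) - 1 - (p - 1) * (1 - s))) (at s)"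
      using s0 by (auto intro!: derivative_eq_intros simp: field_simps)
    moreover have "0 \<le> (p - 2) * (s powr (2 - (p + 1)) - 1 - (p - 1) * (1 - s))"
      using powr_ge_tangent[OF s0, of "p + 1"] p by (intro mult_nonneg_nonneg) (auto simp: algebra_simps)
    ultimately show "\<exists>d. (?D has_real_derivative d) (at s) \<and> 0 \<le> d" by blast
  qed
  then show ?thesis by simp
qed

text \<open>\<open>root\<close> makes \<beta> a zero of the right-hand side, so the tangent bound
  leaves no constant term. The remaining slope changes sign at \<open>\<beta> = (n - p) / p\<close>,
  which is what separates the two roots.\<close>

lemma riccati_rhs_ge:
  fixes p n lam \<beta> y :: real
  assumes p: "2 \<le> p" and lam: "0 \<le> lam" and y: "y > 0" and \<beta>: "\<beta> > 0"
    and root: "lam * \<beta> powr (2 - p) = \<beta> * ((n - p) - (p - 1) * \<beta>)"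
  shows "(p - 1) * ((y - \<beta>)\<^sup>2 - ((n - p) - p * \<beta>) * (y - \<beta>))
    \<le> (p - 1) * y\<^sup>2 - (n - p) * y + lam * y powr (2 - p)"
proof -
  have "lam * \<beta> powr (2 - p) * (1 + (2 - p) * (y / \<beta> - 1)) \<le> lam * \<beta> powr (2 - p) * (y / \<beta>) powr (2 - p)"
    using powr_ge_tangent[of "y / \<beta>" p] p y \<beta> lam by (intro mult_left_mono) auto
  also have "\<dots> = lam * y powr (2 - p)"
    using y \<beta> by (simp add: powr_divide)
  finally have "\<beta> * ((n - p) - (p - 1) * \<beta>) * (1 + (2 - p) * (y / \<beta> - 1)) \<le> lam * y powr (2 - p)"
    unfolding root .
  moreover have "\<beta> * X * (1 + (2 - p) * (y / \<beta> - 1)) = X * (\<beta> + (2 - p) * (y - \<beta>))" for X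
    using \<beta> by (simp add: field_simps)
  ultimately have "((n - p) - (p - 1) * \<beta>) * (\<beta> + (2 - p) * (y - \<beta>)) \<le> lam * y powr (2 - p)"
    by simp
  then show ?thesis by (simp add: algebra_simps power2_eq_square)
qed

text \<open>The second-order Taylor term of \<open>y powr (2 - p)\<close> improves the factor 1 of \<open>riccati_rhs_ge\<close> to
  \<open>p / 2\<close>; this is what produces the exponent \<open>2 / p\<close> of the logarithm.\<close>

lemma riccati_rhs_ge_critical:
  fixes p n lam \<beta> y :: real
  assumes p: "2 \<le> p" and lam: "0 \<le> lam" and y: "y > 0" "y \<le> \<beta>"
    and root: "lam * \<beta> powr (2 - p) = \<beta> * ((n - p) - (p - 1) * \<beta>)" and crit: "\<beta> = (n - p) / p"
  shows "(p - 1) * (p / 2 * (y - \<beta>)\<^sup>2) \<le> (p - 1) * y\<^sup>2 - (n - p) * y + lam * y powr (2 - p)"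
proof -
  have \<beta>: "\<beta> > 0" using y by simp
  have n: "n = p * \<beta> + p" using p by (simp add: crit)
  \<comment> \<open>In the critical case \<open>(n - p) - (p - 1) * \<beta>\<close> equals
    \<open>\<beta>\<close>.\<close>
  have root': "lam * \<beta> powr (2 - p) = \<beta>\<^sup>2"
    unfolding root n by (simp add: algebra_simps power2_eq_square)
  have "\<beta>\<^sup>2 * (1 + (p - 2) * (1 - y / \<beta>) + (p - 2) * (p - 1) / 2 * (1 - y / \<beta>)\<^sup>2)
      \<le> \<beta>\<^sup>2 * (y / \<beta>) powr (2 - p)"
    using y \<beta> p by (intro mult_left_mono powr_ge_parabola) auto
  also have "\<dots> = lam * y powr (2 - p)"
    unfolding root'[symmetric] using y \<beta> by (simp add: powr_divide)
  also have "\<beta>\<^sup>2 * (1 + (p - 2) * (1 - y / \<beta>) + (p - 2) * (p - 1) / 2 * (1 - y / \<beta>)\<^sup>2)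
      = \<beta>\<^sup>2 + (p - 2) * \<beta> * (\<beta> - y) + (p - 2) * (p - 1) / 2 * (\<beta> - y)\<^sup>2"
    using \<beta> by (simp add: field_simps power2_eq_square)
  finally have "\<beta>\<^sup>2 + (p - 2) * \<beta> * (\<beta> - y) + (p - 2) * (p - 1) / 2 * (\<beta> - y)\<^sup>2 \<le> lam * y powr (2 - p)" .
  \<comment> \<open>Constant and linear terms cancel; the squares sum to
    \<open>(p - 1) + (p - 2) * (p - 1) / 2 = (p - 1) * p / 2\<close>.\<close>
  then show ?thesis unfolding n by (simp add: field_simps power2_eq_square)
qed

text \<open>Here \<open>y = - s F' / F\<close>, so
  \<open>s\<^sup>2 F'' / F = y\<^sup>2 + y - s y'\<close>, with \<open>s y' = 2 / L\<^sup>2\<close>.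
  The free factor \<open>t\<close> later scales the profile until it touches the
  supersolution.\<close>

lemma log_profile_derivatives:
  fixes r R t \<beta> :: real
  assumes r: "0 < r" "r < R"
  defines "L \<equiv> \<lambda>s. ln R - ln s"
  defines "F \<equiv> \<lambda>s. t * (s powr (- \<beta>) * (L s)\<^sup>2)"
  defines "y \<equiv> \<lambda>s. \<beta> + 2 / L s"
  shows "(F has_real_derivative - (F r * y r / r)) (at r)"
    and "((\<lambda>s. - (F s * y s / s)) has_real_derivative F r * ((y r)\<^sup>2 + y r - 2 / (L r)\<^sup>2) / r\<^sup>2) (at r)"
proof -
  have L: "L r > 0" using r by (simp add: L_def)
  have dL: "(L has_real_derivative - 1 / r) (at r)"
    unfolding L_def using r by (auto intro!: derivative_eq_intros)
  have dp: "((\<lambda>s. s powr (- \<beta>)) has_real_derivative (- \<beta> * r powr (- \<beta>) / r)) (at r)"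
    using r by (auto intro!: derivative_eq_intros simp: powr_diff)
  show dF: "(F has_real_derivative - (F r * y r / r)) (at r)"
    unfolding F_def y_def
    by (rule DERIV_cong[OF DERIV_cmult[OF DERIV_mult[OF dp DERIV_power[OF dL, of 2]]]])
       (use r L in \<open>simp add: field_simps power2_eq_square\<close>)
  have dy: "(y has_real_derivative 2 / (L r)\<^sup>2 / r) (at r)"
    unfolding y_def using r L
    by (auto intro!: derivative_eq_intros dL simp: field_simps power2_eq_square)
  show "((\<lambda>s. - (F s * y s / s)) has_real_derivative
      F r * ((y r)\<^sup>2 + y r - 2 / (L r)\<^sup>2) / r\<^sup>2) (at r)"
    by (rule DERIV_cong[OF DERIV_minus[OF DERIV_divide[OF DERIV_mult[OF dF dy] DERIV_ident]]])
       (use r L in \<open>simp_all add: field_simps power2_eq_square\<close>)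
qed

section \<open>Asymptotic integration of the Riccati inequality\<close>

lemma riccati_subcritical_bound:
  fixes \<phi> y y' :: "real \<Rightarrow> real"
  assumes r0: "r0 > 0" and \<phi>: "\<And>r. r > r0 \<Longrightarrow> \<phi> r > 0"
    and d\<phi>: "\<And>r. r > r0 \<Longrightarrow> (\<phi> has_real_derivative - (\<phi> r * y r / r)) (at r)"
    and dy: "\<And>r. r > r0 \<Longrightarrow> (y has_real_derivative y' r) (at r)"
    and ric: "\<And>r. r > r0 \<Longrightarrow> r * y' r \<ge> (y r - \<beta>)\<^sup>2 - \<kappa> * (y r - \<beta>)"
    and \<kappa>: "\<kappa> > 0"
  shows "\<exists>C>0. \<forall>r>r0 + 1. \<phi> r \<le> C * r powr (- \<beta>)"
proof -
  define r1 where "r1 = r0 + 1"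
  have r1: "r1 > r0" "r1 > 0" using r0 by (auto simp: r1_def)
  define A where "A = \<bar>r1 powr \<kappa> * (y r1 - \<beta>)\<bar>"
  have u: "y r - \<beta> \<ge> - A * r powr (- \<kappa>)" if r: "r \<ge> r1" for r
  proof -
    \<comment> \<open>\<open>r powr \<kappa>\<close> is the integrating factor of
      \<open>r u' = - \<kappa> u\<close> for \<open>u = y - \<beta>\<close>; the square in
      \<open>ric\<close> only helps.\<close>
    have "r1 powr \<kappa> * (y r1 - \<beta>) \<le> r powr \<kappa> * (y r - \<beta>)"
    proof (rule DERIV_nonneg_imp_nondecreasing[OF r])
      fix s assume s: "r1 \<le> s" "s \<le> r"
      then have s0: "s > r0" "s > 0" using r1 by auto
      have "((\<lambda>s. s powr \<kappa> * (y s - \<beta>)) has_real_derivative s powr \<kappa> / s * (\<kappa> * (y s - \<beta>) + s * y' s)) (at s)"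
        using s0 by (auto intro!: derivative_eq_intros dy simp: field_simps powr_diff)
      moreover have "0 \<le> \<kappa> * (y s - \<beta>) + s * y' s"
        using ric[OF s0(1)] zero_le_power2[of "y s - \<beta>"] by linarith
      then have "0 \<le> s powr \<kappa> / s * (\<kappa> * (y s - \<beta>) + s * y' s)"
        using s0 by (intro mult_nonneg_nonneg) auto
      ultimately show "\<exists>d. ((\<lambda>s. s powr \<kappa> * (y s - \<beta>)) has_real_derivative d) (at s) \<and> 0 \<le> d" by blast
    qed
    then have "- A \<le> r powr \<kappa> * (y r - \<beta>)" by (simp add: A_def)
    then show ?thesis using r r1 by (simp add: powr_minus field_simps)
  qed
  \<comment> \<open>The last summand has derivative \<open>- A * r powr (- \<kappa>) / r\<close>,
    which offsets the possible negative part of \<open>y - \<beta>\<close>. Being nonnegative, it is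
    dropped at the end.\<close>
  let ?P = "\<lambda>r. ln (\<phi> r) + \<beta> * ln r + A / \<kappa> * r powr (- \<kappa>)"
  have P: "?P r \<le> ?P r1" if r: "r \<ge> r1" for r
  proof (rule DERIV_nonpos_imp_nonincreasing[OF r])
    fix s assume s: "r1 \<le> s" "s \<le> r"
    then have s0: "s > r0" "s > 0" using r1 by auto
    have "(?P has_real_derivative - (y s - \<beta> + A * s powr (- \<kappa>)) / s) (at s)"
      using s0 \<phi>[OF s0(1)] \<kappa> by (auto intro!: derivative_eq_intros d\<phi> simp: field_simps powr_diff)
    moreover have "- (y s - \<beta> + A * s powr (- \<kappa>)) / s \<le> 0"
      using u[OF s(1)] s0 by (auto simp: divide_simps)
    ultimately show "\<exists>d. (?P has_real_derivative d) (at s) \<and> d \<le> 0" by blast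
  qed
  define K where "K = ?P r1"
  have "\<phi> r \<le> exp K * r powr (- \<beta>)" if r: "r > r1" for r
  proof -
    have pos: "r > 0" "\<phi> r > 0" using r r1 \<phi>[of r] by auto
    have "A / \<kappa> * r powr (- \<kappa>) \<ge> 0" using \<kappa> by (simp add: A_def)
    then have "ln (\<phi> r) \<le> K + (- \<beta>) * ln r" using P[of r] r by (simp add: K_def)
    then have "exp (ln (\<phi> r)) \<le> exp (K + (- \<beta>) * ln r)" by (simp only: exp_le_cancel_iff)
    then show ?thesis using pos by (simp add: exp_diff exp_minus powr_def divide_inverse)
  qed
  then show ?thesis unfolding r1_def by (intro exI[of _ "exp K"]) simp
qed

text \<open>If \<open>y\<close> ever reaches \<beta> it stays at or above it, and
  \<open>r powr \<beta> * \<phi> r\<close> is nonincreasing from then on, so no logarithm arises.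
  Otherwise \<open>y < \<beta>\<close> throughout and the quadratic inequality can be
  integrated.\<close>

lemma riccati_critical_bound:
  fixes \<phi> y y' :: "real \<Rightarrow> real"
  assumes r0: "r0 > 0" and \<phi>: "\<And>r. r > r0 \<Longrightarrow> \<phi> r > 0"
    and d\<phi>: "\<And>r. r > r0 \<Longrightarrow> (\<phi> has_real_derivative - (\<phi> r * y r / r)) (at r)"
    and dy: "\<And>r. r > r0 \<Longrightarrow> (y has_real_derivative y' r) (at r)"
    and mono: "\<And>r. r > r0 \<Longrightarrow> y' r \<ge> 0"
    and ric: "\<And>r. r > r0 \<Longrightarrow> y r \<le> \<beta> \<Longrightarrow> r * y' r \<ge> p / 2 * (y r - \<beta>)\<^sup>2"
    and p: "p > 0"
  shows "\<exists>C>0. \<exists>R. \<forall>r>R. \<phi> r \<le> C * r powr (- \<beta>) * ln r powr (2 / p)"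
proof (cases "\<exists>r>r0. y r \<ge> \<beta>")
  case True
  then obtain r1 where r1: "r1 > r0" "y r1 \<ge> \<beta>" by blast
  have y: "y r \<ge> \<beta>" if r: "r \<ge> r1" for r
  proof -
    have "y r1 \<le> y r"
      by (rule DERIV_nonneg_imp_nondecreasing[OF r]) (metis dy mono r1(1) less_le_trans)
    then show ?thesis using r1 by simp
  qed
  let ?P = "\<lambda>r. ln (\<phi> r) + \<beta> * ln r"
  have P: "?P r \<le> ?P r1" if r: "r \<ge> r1" for r
  proof (rule DERIV_nonpos_imp_nonincreasing[OF r])
    fix s assume s: "r1 \<le> s" "s \<le> r"
    then have s0: "s > r0" "s > 0" using r1 r0 by auto
    have "(?P has_real_derivative - (y s - \<beta>) / s) (at s)"
      using s0 \<phi>[OF s0(1)] by (auto intro!: derivative_eq_intros d\<phi> simp: field_simps)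
    moreover have "- (y s - \<beta>) / s \<le> 0" using y[OF s(1)] s0 by (auto simp: divide_simps)
    ultimately show "\<exists>d. (?P has_real_derivative d) (at s) \<and> d \<le> 0" by blast
  qed
  define K where "K = ?P r1"
  have "\<phi> r \<le> exp K * r powr (- \<beta>) * ln r powr (2 / p)" if r: "r > max r1 (exp 1)" for r
  proof -
    have pos: "r > 0" "\<phi> r > 0" using r r1 r0 \<phi>[of r] by auto
    have "ln (\<phi> r) \<le> K + (- \<beta>) * ln r" using P[of r] r by (simp add: K_def)
    then have "exp (ln (\<phi> r)) \<le> exp (K + (- \<beta>) * ln r)" by (simp only: exp_le_cancel_iff)
    then have "\<phi> r \<le> exp K * r powr (- \<beta>)" using pos by (simp add: exp_diff exp_minus powr_def divide_inverse)
    moreover have "ln r \<ge> 1" using r pos by (subst ln_ge_iff) auto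
    then have "1 \<le> ln r powr (2 / p)" using p by (intro ge_one_powr_ge_zero) auto
    then have "exp K * r powr (- \<beta>) * 1 \<le> exp K * r powr (- \<beta>) * ln r powr (2 / p)"
      by (intro mult_left_mono) auto
    ultimately show ?thesis by linarith
  qed
  then show ?thesis
    by (intro exI[of _ "exp K"] conjI exI[of _ "max r1 (exp 1)"]) auto
next
  case False
  then have neg: "y r < \<beta>" if "r > r0" for r using that by force
  \<comment> \<open>The shift by 1 gives \<open>ln r1 > 0\<close>, so that
    \<open>ln r - ln r1\<close> can be replaced by \<open>ln r\<close> at the end.\<close>
  define r1 where "r1 = r0 + 1"
  have r1: "r1 > r0" "r1 > 1" using r0 by (auto simp: r1_def)
  have u: "\<beta> - y r \<le> 2 / p / (ln r - ln r1)" if r: "r > r1" for r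
  proof -
    \<comment> \<open>Separation of variables: \<open>1 / (\<beta> - y s)\<close> grows at least as
      fast as \<open>p / 2 * ln s\<close>. Its positive value at \<open>r1\<close> is then
      dropped.\<close>
    let ?f = "\<lambda>s. 1 / (\<beta> - y s) - p / 2 * ln s"
    have "?f r1 \<le> ?f r"
    proof (rule DERIV_nonneg_imp_nondecreasing[of r1 r ?f])
      fix s assume s: "r1 \<le> s" "s \<le> r"
      then have s0: "s > r0" "s > 0" using r1 by auto
      have nz: "\<beta> - y s \<noteq> 0" using neg[OF s0(1)] by simp
      have "((\<lambda>s. 1 / (\<beta> - y s)) has_real_derivative y' s / (y s - \<beta>)\<^sup>2) (at s)"
        using nz s0(1) by (auto intro!: derivative_eq_intros dy simp: power2_eq_square field_simps)
      then have "(?f has_real_derivative y' s / (y s - \<beta>)\<^sup>2 - p / 2 * (1 / s)) (at s)"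
        using s0(2) by (intro DERIV_diff DERIV_cmult DERIV_ln_divide)
      also have "y' s / (y s - \<beta>)\<^sup>2 - p / 2 * (1 / s)
          = (s * y' s - p / 2 * (y s - \<beta>)\<^sup>2) / (s * (y s - \<beta>)\<^sup>2)"
        using nz s0(2) by (simp add: diff_divide_distrib)
      finally have "(?f has_real_derivative (s * y' s - p / 2 * (y s - \<beta>)\<^sup>2) / (s * (y s - \<beta>)\<^sup>2)) (at s)" .
      moreover have "0 \<le> (s * y' s - p / 2 * (y s - \<beta>)\<^sup>2) / (s * (y s - \<beta>)\<^sup>2)"
        using ric[OF s0(1)] neg[OF s0(1)] s0 by simp
      ultimately show "\<exists>d. (?f has_real_derivative d) (at s) \<and> 0 \<le> d" by blast
    qed (use r in simp)
    moreover have "1 / (\<beta> - y r1) > 0" using neg r1 by simp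
    ultimately have "p / 2 * (ln r - ln r1) \<le> 1 / (\<beta> - y r)"
      unfolding right_diff_distrib by linarith
    moreover have "\<beta> - y r > 0" "ln r - ln r1 > 0" using neg[of r] r r1 by auto
    ultimately show ?thesis using p by (simp add: field_simps)
  qed
  \<comment> \<open>The second integration starts away from \<open>r1\<close>, where the bound on
    \<open>\<beta> - y r\<close> blows up.\<close>
  define r2 where "r2 = r1 * exp 1"
  have r2: "r2 > r1" using r1 by (simp add: r2_def)
  have ln2: "ln r2 - ln r1 = 1" using r1 by (simp add: r2_def ln_mult)
  let ?P = "\<lambda>r. ln (\<phi> r) + \<beta> * ln r - 2 / p * ln (ln r - ln r1)"
  have P: "?P r \<le> ?P r2" if r: "r \<ge> r2" for r
  proof (rule DERIV_nonpos_imp_nonincreasing[OF r])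
    fix s assume s: "r2 \<le> s" "s \<le> r"
    then have s0: "s > r0" "s > 0" "s > r1" using r1 r2 by auto
    have l: "ln s - ln r1 > 0" using s0 r1 by auto
    have "(?P has_real_derivative (\<beta> - y s - 2 / p / (ln s - ln r1)) / s) (at s)"
      using s0 l p \<phi>[OF s0(1)]
      by (auto intro!: derivative_eq_intros d\<phi> simp: divide_simps)
    moreover have "(\<beta> - y s - 2 / p / (ln s - ln r1)) / s \<le> 0"
      using u[OF s0(3)] s0 by (intro divide_nonpos_pos) auto
    ultimately show "\<exists>d. (?P has_real_derivative d) (at s) \<and> d \<le> 0" by blast
  qed
  define K where "K = ?P r2"
  have "\<phi> r \<le> exp K * r powr (- \<beta>) * ln r powr (2 / p)" if r: "r > r2" for r
  proof -
    have pos: "r > 0" "r \<noteq> 1" "\<phi> r > 0" using r r1 r2 \<phi>[of r] by auto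
    have l: "0 < ln r - ln r1" "ln r - ln r1 \<le> ln r" using r r1 r2 by auto
    have "2 / p * ln (ln r - ln r1) \<le> 2 / p * ln (ln r)" using l p by (intro mult_left_mono) auto
    then have "ln (\<phi> r) \<le> K + (- \<beta>) * ln r + 2 / p * ln (ln r)" using P[of r] r by (simp add: K_def)
    then have "exp (ln (\<phi> r)) \<le> exp (K + (- \<beta>) * ln r + 2 / p * ln (ln r))"
      by (simp only: exp_le_cancel_iff)
    then show ?thesis using pos l by (simp only: exp_add powr_def) simp
  qed
  then show ?thesis
    by (intro exI[of _ "exp K"] conjI exI[of _ r2]) auto
qed

section \<open>Supersolutions\<close>

lemma C2_supersolD:
  assumes "C2_supersol p lam r0 w"
  shows "\<exists>U. open U \<and> {x. norm x \<ge> r0} \<subseteq> U \<and> (\<forall>x\<in>U. w differentiable (at x))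
      \<and> (\<forall>x\<in>U. grad w differentiable (at x))"
    and "norm x > r0 \<Longrightarrow> plap p w x + lam / norm x powr p * \<bar>w x\<bar> powr (p - 2) * w x \<le> 0"
  using assms unfolding C2_supersol_def C2_on_def by (blast, force)

text \<open>The exponent 2 of the logarithm is a choice: any exponent above 1 makes the profile a strict
  subsolution.\<close>

lemma log_profile_comparison:
  fixes w :: "'a::euclidean_space \<Rightarrow> real" and p lam r0 \<beta> :: real
  assumes super: "C2_supersol p lam r0 w" and w: "\<And>x. norm x \<ge> r0 \<Longrightarrow> w x > 0"
    and p: "2 \<le> p" and lam: "0 \<le> lam" and r0: "r0 > 0"
    and \<beta>: "\<beta> > 0" "\<beta> \<ge> (real DIM('a) - p) / p"
    and root: "lam * \<beta> powr (2 - p) = \<beta> * ((real DIM('a) - p) - (p - 1) * \<beta>)"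
    and m: "m > 0" "\<And>x. norm x = r0 \<Longrightarrow> m \<le> w x"
    and x: "r0 \<le> norm x" "norm x < R"
  shows "m * (norm x powr (- \<beta>) * (ln R - ln (norm x))\<^sup>2) \<le> r0 powr (- \<beta>) * (ln R - ln r0)\<^sup>2 * w x"
proof -
  define L where "L = (\<lambda>s. ln R - ln s)"
  define f where "f = (\<lambda>x::'a. norm x powr (- \<beta>) * (L (norm x))\<^sup>2)"
  define K where "K = cball (0::'a) R - ball 0 r0"
  have K: "z \<in> K \<longleftrightarrow> r0 \<le> norm z \<and> norm z \<le> R" for z by (auto simp: K_def)
  have "compact K" unfolding K_def by (intro compact_diff compact_cball open_ball)
  obtain U where U: "open U" "{x. norm x \<ge> r0} \<subseteq> U" "\<And>x. x \<in> U \<Longrightarrow> w differentiable (at x)"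
    "\<And>x. x \<in> U \<Longrightarrow> grad w differentiable (at x)"
    using C2_supersolD(1)[OF super] by blast
  have inU: "norm z \<ge> r0 \<Longrightarrow> z \<in> U" for z using U(2) by blast
  have "continuous_on K w"
    using U K by (intro continuous_at_imp_continuous_on ballI differentiable_imp_continuous_within) auto
  moreover have "continuous_on K f"
    unfolding f_def L_def using r0 K by (auto intro!: continuous_intros)
  moreover have "\<forall>z\<in>K. w z \<noteq> 0" using w K by force
  ultimately have "continuous_on K (\<lambda>z. f z / w z)" by (intro continuous_intros) auto
  moreover have xK: "x \<in> K" using x K by auto
  ultimately obtain x0 where x0: "x0 \<in> K" and max: "\<And>z. z \<in> K \<Longrightarrow> f z / w z \<le> f x0 / w x0"
    using continuous_attains_sup[OF \<open>compact K\<close>, of "\<lambda>z. f z / w z"] by blast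
  define M where "M = f x0 / w x0"
  have "norm x > 0" using x r0 by linarith
  moreover have "L (norm x) > 0" using ln_strict_mono[OF x(2) \<open>norm x > 0\<close>] by (simp add: L_def)
  ultimately have fx: "f x > 0" by (simp add: f_def)
  have "f x / w x > 0" using fx w x by auto
  then have M: "M > 0" using max[OF xK] by (simp add: M_def)
  have wx0: "w x0 > 0" using w x0 K by auto
  \<comment> \<open>On the outer sphere the logarithm, hence the quotient, vanishes, whereas its
    maximum is at least the positive value at \<open>x\<close>.\<close>
  have "norm x0 \<noteq> R"
  proof
    assume "norm x0 = R"
    then have "M = 0" by (simp add: M_def f_def L_def)
    with M show False by simp
  qed
  then have x0R: "norm x0 < R" using x0 K by force
  have "norm x0 = r0"
  proof (rule ccontr)
    assume "norm x0 \<noteq> r0"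
    then have x0r: "norm x0 > r0" using x0 K by force
    define S where "S = ball (0::'a) R - cball 0 r0"
    have S: "open S" "x0 \<in> S" "0 \<notin> S" using x0R x0r r0 by (auto simp: S_def)
    have SK: "z \<in> S \<Longrightarrow> z \<in> K \<and> r0 < norm z \<and> norm z < R" for z by (auto simp: S_def K)
    define r where "r = norm x0"
    have r: "0 < r" "r < R" using x0r x0R r0 by (auto simp: r_def)
    \<comment> \<open>\<open>F\<close> is the radial form of \<open>f\<close> divided by the maximum
      \<open>M\<close> of the quotient, so \<open>g\<close> lies below \<open>w\<close> on
      \<open>S\<close> and meets it at \<open>x0\<close>.\<close>
    define F where "F = (\<lambda>s. inverse M * (s powr (- \<beta>) * (L s)\<^sup>2))"
    define y where "y = (\<lambda>s. \<beta> + 2 / L s)"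
    define F' where "F' = (\<lambda>s. - (F s * y s / s))"
    define F2 where "F2 = F r * ((y r)\<^sup>2 + y r - 2 / (L r)\<^sup>2) / r\<^sup>2"
    define g where "g = (\<lambda>z::'a. F (norm z))"
    have gf: "g z = f z / M" for z by (simp add: g_def F_def f_def divide_inverse ac_simps)
    have L: "L r > 0" using r by (simp add: L_def)
    have y: "y r > 0" using L \<beta> by (simp add: y_def add_pos_pos)
    have Fr: "F r > 0" using r L M by (simp add: F_def)
    have dF: "(F has_real_derivative F' (norm z)) (at (norm z))" if "z \<in> S" for z
    proof -
      have "0 < norm z" "norm z < R" using SK[OF that] r0 by linarith+
      from log_profile_derivatives(1)[OF this, of "inverse M" \<beta>]
      show ?thesis unfolding F_def F'_def y_def L_def .
    qed
    have dF': "(F' has_real_derivative F2) (at (norm x0))"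
      unfolding F_def F'_def F2_def y_def L_def r_def
      by (rule log_profile_derivatives(2)) (use r in \<open>auto simp: r_def\<close>)
    note rd = radial_derivatives[of S x0 g F F' F2, OF S _ dF dF']
    have gdiff: "g differentiable (at z)" if "z \<in> S" for z
      using rd(1)[OF _ _ that] by (auto simp: g_def differentiable_def)
    have ggrad: "grad g differentiable (at x0)"
      using rd(2) by (auto simp: g_def differentiable_def)
    have gx0: "grad g x0 = (F' r / r) *\<^sub>R x0"
      using grad_eqI[OF rd(1)[OF _ _ S(2)]] by (auto simp: g_def r_def)
    have F'r: "F' r < 0" using Fr y r by (simp add: F'_def)
    then have nz: "grad g x0 \<noteq> 0" using r by (auto simp: gx0 r_def)
    have gw: "g x0 = w x0" using M wx0 by (auto simp: gf M_def)
    have "plap p g x0 \<le> plap p w x0"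
    proof (rule plap_mono_touching[where f = g and w = w, OF p S(1,2) gw])
      fix z assume z: "z \<in> S"
      then have "f z / w z \<le> M" "w z > 0" using SK[OF z] max w by (auto simp: M_def)
      then show "g z \<le> w z" using M by (simp add: gf field_simps)
      show "w differentiable (at z)" using SK[OF z] by (intro U(3) inU) simp
    next
      show "grad w differentiable (at x0)" using x0r by (intro U(4) inU) simp
    qed (use gdiff ggrad nz in auto)
    moreover have "plap p g x0 = \<bar>F' r\<bar> powr (p - 2) * ((p - 1) * F2 + (real DIM('a) - 1) * F' r / r)"
      unfolding r_def
      by (rule plap_radial[OF S _ dF dF']) (use F'r in \<open>auto simp: g_def r_def\<close>)
    ultimately have "\<bar>F' r\<bar> powr (p - 2) * ((p - 1) * F2 + (real DIM('a) - 1) * F' r / r)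
        + lam / r powr p * \<bar>F r\<bar> powr (p - 2) * F r \<le> 0"
      using C2_supersolD(2)[OF super x0r] gw by (simp add: g_def r_def)
    moreover have "\<bar>F' r\<bar> powr (p - 2) * ((p - 1) * F2 + (real DIM('a) - 1) * F' r / r)
        + lam / r powr p * \<bar>F r\<bar> powr (p - 2) * F r
      = F r * \<bar>F' r\<bar> powr (p - 2) / r\<^sup>2 *
        ((p - 1) * (r\<^sup>2 * F2 / F r) - (real DIM('a) - 1) * y r + lam * y r powr (2 - p))"
      using Fr y r by (intro radial_residual) (auto simp: F'_def)
    moreover have "F r * \<bar>F' r\<bar> powr (p - 2) / r\<^sup>2 > 0" using Fr F'r r by simp
    ultimately have "(p - 1) * (r\<^sup>2 * F2 / F r) - (real DIM('a) - 1) * y r + lam * y r powr (2 - p) \<le> 0"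
      by (metis mult_pos_pos not_le)
    moreover have "r\<^sup>2 * F2 / F r = (y r)\<^sup>2 + y r - 2 / (L r)\<^sup>2"
      using r Fr by (simp add: F2_def)
    ultimately have "(p - 1) * ((y r)\<^sup>2 + y r - 2 / (L r)\<^sup>2) - (real DIM('a) - 1) * y r + lam * y r powr (2 - p) \<le> 0"
      by (simp only:)
    then have "(p - 1) * (y r)\<^sup>2 - (real DIM('a) - p) * y r + lam * y r powr (2 - p) \<le> (p - 1) * (2 / (L r)\<^sup>2)"
      by (simp add: algebra_simps)
    with riccati_rhs_ge[OF p lam y \<beta>(1) root]
    have "(p - 1) * ((y r - \<beta>)\<^sup>2 - ((real DIM('a) - p) - p * \<beta>) * (y r - \<beta>)) \<le> (p - 1) * (2 / (L r)\<^sup>2)"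
      by linarith
    then have "(y r - \<beta>)\<^sup>2 - ((real DIM('a) - p) - p * \<beta>) * (y r - \<beta>) \<le> 2 / (L r)\<^sup>2"
      by (rule mult_left_le_imp_le) (use p in simp)
    \<comment> \<open>This is where the larger root is needed: its linear coefficient is
      nonpositive, while \<open>y r > \<beta>\<close>.\<close>
    moreover have "((real DIM('a) - p) - p * \<beta>) * (y r - \<beta>) \<le> 0"
      using \<beta>(2) p L by (intro mult_nonpos_nonneg) (auto simp: y_def field_simps)
    \<comment> \<open>The exponent 2 of the logarithm enters squared here, but only linearly in
      \<open>2 / (L r)\<^sup>2\<close>, which stems from the derivative of \<open>y\<close>.\<close>
    moreover have "(y r - \<beta>)\<^sup>2 = 4 / (L r)\<^sup>2" by (simp add: y_def power_divide)
    ultimately have "4 / (L r)\<^sup>2 \<le> 2 / (L r)\<^sup>2" by linarith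
    then show False using L by (simp add: field_simps)
  qed
  then have "m \<le> w x0" "f x0 = r0 powr (- \<beta>) * (ln R - ln r0)\<^sup>2"
    using m(2) by (auto simp: f_def L_def)
  moreover have "f x * w x0 \<le> f x0 * w x"
    using max[OF xK] wx0 w[of x] x by (simp add: field_simps)
  moreover have "m * f x \<le> f x * w x0" using \<open>m \<le> w x0\<close> fx by simp
  ultimately show ?thesis by (simp add: f_def L_def)
qed

lemma supersolution_lower_bound:
  fixes w :: "'a::euclidean_space \<Rightarrow> real" and p lam r0 \<beta> :: real
  assumes super: "C2_supersol p lam r0 w" and w: "\<And>x. norm x \<ge> r0 \<Longrightarrow> w x > 0"
    and p: "2 \<le> p" and lam: "0 \<le> lam" and r0: "r0 > 0"
    and \<beta>: "\<beta> > 0" "\<beta> \<ge> (real DIM('a) - p) / p"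
    and root: "lam * \<beta> powr (2 - p) = \<beta> * ((real DIM('a) - p) - (p - 1) * \<beta>)"
  shows "\<exists>C>0. \<forall>x. norm x \<ge> r0 \<longrightarrow> norm x powr (- \<beta>) \<le> C * w x"
proof -
  obtain U where U: "open U" "{x. norm x \<ge> r0} \<subseteq> U" "\<And>x. x \<in> U \<Longrightarrow> w differentiable (at x)"
    using C2_supersolD(1)[OF super] by blast
  have inU: "norm z \<ge> r0 \<Longrightarrow> z \<in> U" for z using U(2) by blast
  have "continuous_on (sphere 0 r0) w"
    using U by (intro continuous_at_imp_continuous_on ballI differentiable_imp_continuous_within) auto
  moreover obtain e :: 'a where "norm e = r0" using vector_choose_size[of r0] r0 by auto
  then have "sphere (0::'a) r0 \<noteq> {}" by auto
  ultimately obtain x1 where x1: "norm x1 = r0" "\<And>x. norm x = r0 \<Longrightarrow> w x1 \<le> w x"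
    using continuous_attains_inf[OF compact_sphere] by (metis dist_0_norm mem_sphere)
  define m where "m = w x1"
  have m: "m > 0" "\<And>x. norm x = r0 \<Longrightarrow> m \<le> w x" using x1 w by (auto simp: m_def)
  have "m * norm x powr (- \<beta>) \<le> r0 powr (- \<beta>) * w x" if x: "norm x \<ge> r0" for x
  proof -
    \<comment> \<open>Division by \<open>(ln R - ln r0)\<^sup>2\<close> leaves a quotient of
      logarithms tending to 1, so none survives in the bound.\<close>
    have "((\<lambda>R. m * norm x powr (- \<beta>) * ((ln R - ln (norm x)) / (ln R - ln r0))\<^sup>2) \<longlongrightarrow>
        m * norm x powr (- \<beta>) * 1\<^sup>2) at_top"
      by (intro tendsto_intros) real_asymp
    moreover have "eventually (\<lambda>R. m * norm x powr (- \<beta>) * ((ln R - ln (norm x)) / (ln R - ln r0))\<^sup>2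
        \<le> r0 powr (- \<beta>) * w x) at_top"
      using eventually_gt_at_top[of "norm x"]
    proof eventually_elim
      case (elim R)
      then have "ln R - ln r0 > 0" using x r0 by auto
      then show ?case
        using log_profile_comparison[OF super w p lam r0 \<beta> root m x elim]
        by (simp add: power_divide field_simps)
    qed
    ultimately have "m * norm x powr (- \<beta>) * 1\<^sup>2 \<le> r0 powr (- \<beta>) * w x"
      by (rule tendsto_upperbound) simp
    then show ?thesis by simp
  qed
  then show ?thesis using m r0
    by (intro exI[of _ "r0 powr (- \<beta>) / m"]) (auto simp: field_simps)
qed

section \<open>From radial supersolutions to the Riccati inequality\<close>

text \<open>Restriction of \<open>v\<close> to a ray makes \<phi> twice differentiable beyond
  \<open>r0\<close>; \<open>dec\<close> gives the sign that makes
  \<open>y = - r \<phi>' / \<phi>\<close> positive. The inequality follows from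
  \<open>radial_residual\<close> and
  \<open>r y' = y + y\<^sup>2 - r\<^sup>2 \<phi>'' / \<phi>\<close>.\<close>

lemma radial_supersolution_riccati:
  fixes v :: "'a::euclidean_space \<Rightarrow> real" and p lam r0 :: real
  assumes super: "C2_supersol p lam r0 v" and v: "\<And>x. norm x \<ge> r0 \<Longrightarrow> v x > 0"
    and \<phi>: "\<And>x. norm x \<ge> r0 \<Longrightarrow> v x = \<phi> (norm x)"
    and dec: "\<And>r. r \<ge> r0 \<Longrightarrow> \<exists>d<0. (\<phi> has_real_derivative d) (at r within {r0..})"
    and r0: "r0 > 0"
  obtains y y' :: "real \<Rightarrow> real" where "\<And>r. r > r0 \<Longrightarrow> y r > 0"
    and "\<And>r. r > r0 \<Longrightarrow> (\<phi> has_real_derivative - (\<phi> r * y r / r)) (at r)"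
    and "\<And>r. r > r0 \<Longrightarrow> (y has_real_derivative y' r) (at r)"
    and "\<And>r. r > r0 \<Longrightarrow>
      (p - 1) * y r ^ 2 - (real DIM('a) - p) * y r + lam * y r powr (2 - p) \<le> (p - 1) * (r * y' r)"
proof -
  obtain U where U: "open U" "{x. norm x \<ge> r0} \<subseteq> U" "\<And>x. x \<in> U \<Longrightarrow> v differentiable (at x)"
    "\<And>x. x \<in> U \<Longrightarrow> grad v differentiable (at x)"
    using C2_supersolD(1)[OF super] by blast
  obtain e :: 'a where e: "norm e = 1" using vector_choose_size[of 1] by auto
  define \<phi>' where "\<phi>' = (\<lambda>r. grad v (r *\<^sub>R e) \<bullet> e)"
  define \<phi>2 where "\<phi>2 = (\<lambda>r. frechet_derivative (grad v) (at (r *\<^sub>R e)) e \<bullet> e)"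
  have inU: "r *\<^sub>R e \<in> U" if "r > r0" for r using that r0 U(2) e by auto
  have dl: "((\<lambda>t. t *\<^sub>R e) has_derivative (\<lambda>t. t *\<^sub>R e)) (at t)" for t :: real
    by (auto intro!: derivative_eq_intros)
  have d\<phi>: "(\<phi> has_real_derivative \<phi>' r) (at r)" if r: "r > r0" for r
  proof (rule has_field_derivative_transform_within_open[of "\<lambda>t. v (t *\<^sub>R e)" _ _ "{r0<..}"])
    show "((\<lambda>t. v (t *\<^sub>R e)) has_real_derivative \<phi>' r) (at r)"
      using has_derivative_compose[OF dl has_derivative_grad[OF U(3)[OF inU[OF r]]]]
      by (simp add: has_field_derivative_def \<phi>'_def mult_commute_abs)
    show "v (t *\<^sub>R e) = \<phi> t" if "t \<in> {r0<..}" for t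
      using \<phi>[of "t *\<^sub>R e"] that r0 e by simp
  qed (use r in auto)
  have d\<phi>': "(\<phi>' has_real_derivative \<phi>2 r) (at r)" if r: "r > r0" for r
  proof -
    let ?D = "frechet_derivative (grad v) (at (r *\<^sub>R e))"
    have D: "(grad v has_derivative ?D) (at (r *\<^sub>R e))"
      using U(4)[OF inU[OF r]] frechet_derivative_works by blast
    then interpret linear ?D by (rule has_derivative_linear)
    have "((\<lambda>t. grad v (t *\<^sub>R e) \<bullet> e) has_derivative (\<lambda>t. ?D (t *\<^sub>R e) \<bullet> e)) (at r)"
      by (rule has_derivative_inner_left, rule has_derivative_compose[OF dl D])
    then show ?thesis
      unfolding has_field_derivative_def \<phi>'_def \<phi>2_def by (simp add: scale mult_commute_abs)
  qed
  have neg: "\<phi>' r < 0" if r: "r > r0" for r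
  proof -
    obtain d where "d < 0" "(\<phi> has_real_derivative d) (at r within {r0..})"
      using dec[of r] r by auto
    moreover have "at r within {r0..} = at r" using r by (intro at_within_interior) (simp add: interior_real_atLeast)
    ultimately show ?thesis using DERIV_unique[OF d\<phi>[OF r]] by metis
  qed
  have pos: "\<phi> r > 0" if "r > r0" for r
    using v[of "r *\<^sub>R e"] \<phi>[of "r *\<^sub>R e"] that r0 e by simp
  define y where "y = (\<lambda>r. - (r * \<phi>' r / \<phi> r))"
  define y' where "y' = (\<lambda>r. (y r + (y r)\<^sup>2 - r\<^sup>2 * \<phi>2 r / \<phi> r) / r)"
  show thesis
  proof (rule that[of y y'])
    fix r assume r: "r > r0"
    then have rp: "r > 0" using r0 by simp
    note pr = pos[OF r] and nr = neg[OF r]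
    show y: "y r > 0" using pr nr rp by (simp add: y_def divide_neg_pos mult_pos_neg)
    have \<phi>'y: "\<phi>' r = - (\<phi> r * y r / r)" using pr rp by (simp add: y_def)
    with d\<phi>[OF r] show "(\<phi> has_real_derivative - (\<phi> r * y r / r)) (at r)" by simp
    show "(y has_real_derivative y' r) (at r)"
      unfolding y_def
      by (rule DERIV_cong[OF DERIV_minus[OF DERIV_divide[OF DERIV_mult[OF DERIV_ident d\<phi>'[OF r]] d\<phi>[OF r]]]])
         (use pr rp in \<open>simp_all add: y'_def y_def field_simps power2_eq_square\<close>)
    let ?x = "r *\<^sub>R e"
    have nx: "norm ?x = r" using e rp by simp
    have S: "open (- cball (0::'a) r0)" "?x \<in> - cball 0 r0" "0 \<notin> - cball (0::'a) r0"
      using r r0 nx by auto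
    have "plap p v ?x = \<bar>\<phi>' (norm ?x)\<bar> powr (p - 2) *
        ((p - 1) * \<phi>2 r + (real DIM('a) - 1) * \<phi>' (norm ?x) / norm ?x)"
      by (rule plap_radial[OF S, where F = \<phi>]) (use \<phi> d\<phi> d\<phi>'[OF r] nr nx in auto)
    moreover have "plap p v ?x + lam / r powr p * \<bar>\<phi> r\<bar> powr (p - 2) * \<phi> r \<le> 0"
      using C2_supersolD(2)[OF super, of ?x] \<phi>[of ?x] r nx by simp
    ultimately have "\<phi> r * \<bar>\<phi>' r\<bar> powr (p - 2) / r\<^sup>2 *
        ((p - 1) * (r\<^sup>2 * \<phi>2 r / \<phi> r) - (real DIM('a) - 1) * y r + lam * y r powr (2 - p)) \<le> 0"
      using radial_residual[OF pr y rp \<phi>'y, of p "\<phi>2 r" "real DIM('a)" lam] nx by simp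
    moreover have "\<phi> r * \<bar>\<phi>' r\<bar> powr (p - 2) / r\<^sup>2 > 0" using pr nr rp by simp
    ultimately have "(p - 1) * (r\<^sup>2 * \<phi>2 r / \<phi> r) - (real DIM('a) - 1) * y r + lam * y r powr (2 - p) \<le> 0"
      by (metis mult_pos_pos not_le)
    moreover have "r * y' r = y r + (y r)\<^sup>2 - r\<^sup>2 * \<phi>2 r / \<phi> r" using rp by (simp add: y'_def)
    then have "(p - 1) * (r * y' r) = (p - 1) * y r + (p - 1) * (y r)\<^sup>2 - (p - 1) * (r\<^sup>2 * \<phi>2 r / \<phi> r)"
      by (simp only: right_diff_distrib distrib_left)
    ultimately show "(p - 1) * y r ^ 2 - (real DIM('a) - p) * y r + lam * y r powr (2 - p) \<le> (p - 1) * (r * y' r)"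
      by (simp add: algebra_simps)
  qed
qed

text \<open>Both claims in (b) are reached through a positive lower bound for all large
  \<open>norm x\<close>, so the argument passes through the limit inferior.\<close>

lemma Limsup_at_infinity_pos:
  fixes f :: "'a::euclidean_space \<Rightarrow> real"
  assumes "c > 0" and "\<And>x. norm x > R \<Longrightarrow> c \<le> f x"
  shows "Limsup at_infinity (\<lambda>x. ereal (f x)) > 0"
proof -
  have "eventually (\<lambda>x::'a. ereal c \<le> ereal (f x)) at_infinity"
    unfolding eventually_at_infinity using assms(2) by (intro exI[of _ "R + 1"]) auto
  then have "ereal c \<le> Liminf at_infinity (\<lambda>x. ereal (f x))" by (rule Liminf_bounded)
  also have "\<dots> \<le> Limsup at_infinity (\<lambda>x. ereal (f x))"
    by (rule Liminf_le_Limsup[OF trivial_limit_at_infinity])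
  finally show ?thesis using assms(1) by (metis ereal_less(2) less_le_trans)
qed

section \<open>The indicial equation\<close>

text \<open>The left side of the exponent equation in the nonnegative variable
  \<open>b = - a\<close>, which removes the absolute value.\<close>

definition indicial :: "real \<Rightarrow> real \<Rightarrow> real \<Rightarrow> real" where
  "indicial p n b = b powr (p - 1) * ((n - p) - (p - 1) * b)"

lemma indicial_minus:
  assumes "a \<le> 0"
  shows "a * \<bar>a\<bar> powr (p - 2) * (p - n - (p - 1) * a) = indicial p n (- a)"
proof (cases "a = 0")
  case False
  then have "(- a) powr (p - 1) = (- a) * (- a) powr (p - 2)"
    using assms powr_mult_base[of "- a" "p - 2"] by (simp add: algebra_simps)
  then show ?thesis using assms by (simp add: indicial_def algebra_simps)
qed (simp add: indicial_def)

text \<open>At this \<open>b\<close> the factor \<open>(n - p) - (p - 1) * b\<close> equals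
  \<open>b\<close> itself.\<close>

lemma indicial_max:
  assumes "0 < p" "p < n"
  shows "indicial p n ((n - p) / p) = \<bar>(p - n) / p\<bar> powr p"
proof -
  define b where "b = (n - p) / p"
  have b: "b > 0" "\<bar>(p - n) / p\<bar> = b" "n - p = p * b"
    using assms by (auto simp: b_def abs_if field_simps)
  have "b powr p = b * b powr (p - 1)" using powr_mult_base[of b "p - 1"] b(1) by simp
  then show ?thesis unfolding b_def[symmetric] b(2) by (simp add: indicial_def b(3) algebra_simps)
qed

text \<open>Multiplication by \<open>b powr (2 - p)\<close> turns the exponent equation into the
  statement that \<open>b\<close> is a zero of the Riccati right-hand side, the form taken by
  \<open>riccati_rhs_ge\<close>.\<close>

lemma indicial_root_divided:
  assumes "b > 0" "indicial p n b = lam"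
  shows "lam * b powr (2 - p) = b * ((n - p) - (p - 1) * b)"
proof -
  have "b powr (p - 1) * b powr (2 - p) = b" using assms(1) by (simp add: powr_add[symmetric])
  then show ?thesis unfolding assms(2)[symmetric] indicial_def by (simp add: ac_simps)
qed

text \<open>\<open>indicial\<close> vanishes at \<open>0\<close> and
  \<open>(n - p) / (p - 1)\<close> and is at least \<open>lam\<close> at \<open>(n - p) / p\<close>,
  so the intermediate value theorem gives a root on either side of the latter. Both lie among
  \<open>- \<alpha>\<close> and \<open>- \<alpha>'\<close>, and \<open>ord\<close> decides the
  sides.\<close>

lemma indicial_roots:
  assumes p: "2 \<le> p" "p < n" and lam: "0 \<le> lam" "lam \<le> \<bar>(p - n) / p\<bar> powr p"
    and roots: "{a. (p - n) / (p - 1) \<le> a \<and> a \<le> 0 \<and>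
                   a * \<bar>a\<bar> powr (p - 2) * (p - n - (p - 1) * a) = lam} = {\<alpha>, \<alpha>'}"
    and ord: "\<alpha> \<le> \<alpha>'"
  shows "indicial p n (- \<alpha>) = lam" "\<alpha> \<le> (p - n) / p"
    and "indicial p n (- \<alpha>') = lam" "(p - n) / p \<le> \<alpha>'" "\<alpha>' \<le> 0"
proof -
  have root: "(p - n) / (p - 1) \<le> a \<and> a \<le> 0 \<and> indicial p n (- a) = lam \<longleftrightarrow> a = \<alpha> \<or> a = \<alpha>'" for a
  proof -
    have "a = \<alpha> \<or> a = \<alpha>' \<longleftrightarrow> a \<in> {a. (p - n) / (p - 1) \<le> a \<and> a \<le> 0 \<and>
        a * \<bar>a\<bar> powr (p - 2) * (p - n - (p - 1) * a) = lam}"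
      unfolding roots by blast
    then show ?thesis unfolding mem_Collect_eq using indicial_minus[of a p n] by metis
  qed
  show "indicial p n (- \<alpha>) = lam" "indicial p n (- \<alpha>') = lam" "\<alpha>' \<le> 0"
    using root by blast+
  let ?b = "(n - p) / p" and ?B = "(n - p) / (p - 1)"
  have b: "0 < ?b" "?b \<le> ?B" using p by (auto intro!: divide_left_mono)
  have cont: "continuous_on {c..d} (indicial p n)" if "0 \<le> c" for c d
    unfolding indicial_def using p that by (intro continuous_intros continuous_on_powr') auto
  have max: "lam \<le> indicial p n ?b" using lam indicial_max[of p n] p by simp
  have "indicial p n ?B = 0" "indicial p n 0 = 0" using p by (auto simp: indicial_def)
  then have ends: "indicial p n ?B \<le> lam" "indicial p n 0 \<le> lam" using lam by simp_all
  obtain c where c: "?b \<le> c" "c \<le> ?B" "indicial p n c = lam"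
    using IVT2'[OF ends(1) max b(2) cont[OF less_imp_le[OF b(1)]]] by blast
  obtain d where d: "0 \<le> d" "d \<le> ?b" "indicial p n d = lam"
    using IVT'[OF ends(2) max less_imp_le[OF b(1)] cont[OF order_refl]] by blast
  have neg: "(p - n) / (p - 1) = - ?B" "(p - n) / p = - ?b"
    by (simp_all add: minus_divide_left)
  have "- c = \<alpha> \<or> - c = \<alpha>'" "- d = \<alpha> \<or> - d = \<alpha>'"
    unfolding root[symmetric] neg using b c d by auto
  then show "\<alpha> \<le> (p - n) / p" "(p - n) / p \<le> \<alpha>'"
    unfolding neg using c(1) d(2) ord by auto
qed

theorem theorem4p1:
  fixes N :: nat and p r0 lam \<alpha> \<alpha>' :: real
  assumes dim: "DIM('a::euclidean_space) = N"
    and N2: "N \<ge> 2"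
    and p: "2 \<le> p" "p < real N"
    and r0: "r0 > 0"
    and lam: "0 \<le> lam" "lam \<le> \<bar>(p - real N) / p\<bar> powr p"
    and roots: "{a. (p - real N) / (p - 1) \<le> a \<and> a \<le> 0 \<and>
                   a * \<bar>a\<bar> powr (p - 2) * (p - real N - (p - 1) * a) = lam} = {\<alpha>, \<alpha>'}"
    and ord: "\<alpha> \<le> \<alpha>'"
  shows
    "(\<forall>w :: 'a \<Rightarrow> real.
        C2_supersol p lam r0 w \<and> (\<forall>x. norm x \<ge> r0 \<longrightarrow> w x > 0) \<longrightarrow>
        (\<exists>C>0. \<forall>x. norm x \<ge> r0 \<longrightarrow> norm x powr \<alpha> \<le> C * w x))
     \<and>
     (\<forall>(v :: 'a \<Rightarrow> real) (\<phi> :: real \<Rightarrow> real).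
        C2_supersol p lam r0 v \<and> (\<forall>x. norm x \<ge> r0 \<longrightarrow> v x > 0) \<and>
        (\<forall>x. norm x \<ge> r0 \<longrightarrow> v x = \<phi> (norm x)) \<and>
        (\<forall>r\<ge>r0. \<exists>d<0. (\<phi> has_real_derivative d) (at r within {r0..})) \<longrightarrow>
        (lam < \<bar>(p - real N) / p\<bar> powr p \<longrightarrow>
           Limsup at_infinity (\<lambda>x. ereal (norm x powr \<alpha>' / v x)) > 0) \<and>
        (lam = \<bar>(p - real N) / p\<bar> powr p \<longrightarrow>
           (\<forall>\<tau>>0. Limsup at_infinity (\<lambda>x. ereal (norm x powr ((p - real N) / p)
                 * ln (norm x) powr (2 / p) * ln (ln (norm x)) powr \<tau> / v x)) > 0)))"
proof (intro conjI allI impI)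
  note n = dim[symmetric]
  note R = indicial_roots[OF p lam roots ord]
  have crit_pos: "(real N - p) / p > 0" using p by simp
  have crit_neg: "(p - real N) / p = - ((real N - p) / p)" by (simp add: minus_divide_left)
  {
    fix w :: "'a \<Rightarrow> real"
    assume w: "C2_supersol p lam r0 w \<and> (\<forall>x. norm x \<ge> r0 \<longrightarrow> w x > 0)"
    have ge: "- \<alpha> \<ge> (real N - p) / p" using R(2) crit_neg by linarith
    then have pos: "- \<alpha> > 0" using crit_pos by linarith
    show "\<exists>C>0. \<forall>x. norm x \<ge> r0 \<longrightarrow> norm x powr \<alpha> \<le> C * w x"
      using supersolution_lower_bound[of p lam r0 w "- \<alpha>"] w p lam r0 pos ge
        indicial_root_divided[OF pos R(1)] unfolding n by auto
  }
  fix v :: "'a \<Rightarrow> real" and \<phi> :: "real \<Rightarrow> real"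
  assume A: "C2_supersol p lam r0 v \<and> (\<forall>x. norm x \<ge> r0 \<longrightarrow> v x > 0) \<and>
        (\<forall>x. norm x \<ge> r0 \<longrightarrow> v x = \<phi> (norm x)) \<and>
        (\<forall>r\<ge>r0. \<exists>d<0. (\<phi> has_real_derivative d) (at r within {r0..}))"
  then have super: "C2_supersol p lam r0 v"
    and v: "\<And>x. norm x \<ge> r0 \<Longrightarrow> v x > 0" "\<And>x. norm x \<ge> r0 \<Longrightarrow> v x = \<phi> (norm x)"
    and dec: "\<And>r. r \<ge> r0 \<Longrightarrow> \<exists>d<0. (\<phi> has_real_derivative d) (at r within {r0..})"
    by auto
  obtain y y' :: "real \<Rightarrow> real" where y: "\<And>r. r > r0 \<Longrightarrow> y r > 0"
    and d\<phi>: "\<And>r. r > r0 \<Longrightarrow> (\<phi> has_real_derivative - (\<phi> r * y r / r)) (at r)"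
    and dy: "\<And>r. r > r0 \<Longrightarrow> (y has_real_derivative y' r) (at r)"
    and ric: "\<And>r. r > r0 \<Longrightarrow>
      (p - 1) * y r ^ 2 - (real N - p) * y r + lam * y r powr (2 - p) \<le> (p - 1) * (r * y' r)"
    by (rule radial_supersolution_riccati[OF super v dec r0, unfolded dim]) blast+
  have \<phi>: "\<phi> r > 0" if r: "r > r0" for r
  proof -
    obtain x :: 'a where "norm x = r" by (rule vector_choose_size[of r]) (use r r0 in auto)
    then show ?thesis using v[of x] r by simp
  qed
  have p1: "p - 1 > 0" using p by simp
  have ric1: "(y r - \<beta>)\<^sup>2 - ((real N - p) - p * \<beta>) * (y r - \<beta>) \<le> r * y' r"
    if "r > r0" "\<beta> > 0" "indicial p N \<beta> = lam" for r \<beta>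
    by (rule mult_left_le_imp_le[OF order_trans[OF riccati_rhs_ge[OF p(1) lam(1) y[OF that(1)]
          that(2) indicial_root_divided[OF that(2,3)]] ric[OF that(1)]] p1])
  {
    assume sub: "lam < \<bar>(p - real N) / p\<bar> powr p"
    define \<beta> where "\<beta> = - \<alpha>'"
    have \<beta>: "0 \<le> \<beta>" "\<beta> \<le> (real N - p) / p" "indicial p N \<beta> = lam"
      using R(3-5) crit_neg by (auto simp: \<beta>_def)
    have "\<exists>C>0. \<exists>R. \<forall>r>R. \<phi> r \<le> C * r powr (- \<beta>)"
    proof (cases "\<beta> = 0")
      \<comment> \<open>Here \<open>lam = 0\<close>. \<open>ric1\<close> asks for a positive
        \<beta>, but boundedness of the decreasing \<phi> suffices.\<close>
      case True
      have "\<phi> r \<le> \<phi> (r0 + 1)" if "r \<ge> r0 + 1" for r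
      proof (rule DERIV_nonpos_imp_nonincreasing[OF that])
        fix s assume s: "r0 + 1 \<le> s" "s \<le> r"
        then have "- (\<phi> s * y s / s) \<le> 0" using \<phi>[of s] y[of s] r0 by simp
        then show "\<exists>d. (\<phi> has_real_derivative d) (at s) \<and> d \<le> 0" using d\<phi>[of s] s by auto
      qed
      then show ?thesis using \<phi>[of "r0 + 1"] r0 True
        by (intro exI[of _ "\<phi> (r0 + 1)"] conjI exI[of _ "r0 + 1"]) auto
    next
      case False
      then have pos: "\<beta> > 0" using \<beta> by simp
      \<comment> \<open>The strict bound \<open>sub\<close> keeps \<beta> off the critical value,
        which makes the decay rate \<kappa> positive.\<close>
      have "\<beta> \<noteq> (real N - p) / p" using \<beta>(3) sub indicial_max[of p N] p by auto
      then have "(real N - p) - p * \<beta> > 0" using \<beta>(2) p by (simp add: field_simps)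
      from riccati_subcritical_bound[OF r0 \<phi> d\<phi> dy ric1[OF _ pos \<beta>(3)] this]
      show ?thesis by blast
    qed
    then obtain C R where C: "C > 0" "\<And>r. r > R \<Longrightarrow> \<phi> r \<le> C * r powr (- \<beta>)" by blast
    show "Limsup at_infinity (\<lambda>x::'a. ereal (norm x powr \<alpha>' / v x)) > 0"
    proof (rule Limsup_at_infinity_pos[of "1 / C" "max R r0"])
      fix x :: 'a assume x: "norm x > max R r0"
      then have "v x > 0" "v x \<le> C * norm x powr \<alpha>'" using v[of x] C(2)[of "norm x"] by (auto simp: \<beta>_def)
      then show "1 / C \<le> norm x powr \<alpha>' / v x" using C(1) by (simp add: field_simps)
    qed (use C in simp)
  }
  fix \<tau> :: real assume crit: "lam = \<bar>(p - real N) / p\<bar> powr p" and \<tau>: "\<tau> > 0"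
  define \<beta> where "\<beta> = (real N - p) / p"
  have pos: "\<beta> > 0" using crit_pos by (simp add: \<beta>_def)
  have root: "indicial p N \<beta> = lam" using indicial_max[of p N] p by (simp add: \<beta>_def crit)
  \<comment> \<open>At the critical \<beta> the linear term is zero. Unlike \<open>ric2\<close> this
    holds without \<open>y r \<le> \<beta>\<close>, so it makes \<open>y\<close> nondecreasing
    everywhere.\<close>
  have sq: "(y r - \<beta>)\<^sup>2 \<le> r * y' r" if "r > r0" for r
    using ric1[OF that pos root] p by (simp add: \<beta>_def)
  have mono: "y' r \<ge> 0" if "r > r0" for r
  proof -
    have "0 \<le> r * y' r" using sq[OF that] zero_le_power2[of "y r - \<beta>"] by linarith
    then show ?thesis using that r0 by (simp add: zero_le_mult_iff)
  qed
  have ric2: "p / 2 * (y r - \<beta>)\<^sup>2 \<le> r * y' r" if "r > r0" "y r \<le> \<beta>" for r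
    by (rule mult_left_le_imp_le[OF order_trans[OF riccati_rhs_ge_critical[OF p(1) lam(1) y[OF that(1)]
          that(2) indicial_root_divided[OF pos root] \<beta>_def] ric[OF that(1)]] p1])
  obtain C R where C: "C > 0" "\<And>r. r > R \<Longrightarrow> \<phi> r \<le> C * r powr (- \<beta>) * ln r powr (2 / p)"
    using riccati_critical_bound[OF r0 \<phi> d\<phi> dy mono ric2] p by force
  show "Limsup at_infinity (\<lambda>x::'a. ereal (norm x powr ((p - real N) / p)
          * ln (norm x) powr (2 / p) * ln (ln (norm x)) powr \<tau> / v x)) > 0"
  \<comment> \<open>Beyond \<open>exp (exp 1)\<close> the iterated logarithm exceeds 1, so its power
    only enlarges the quotient, whatever \<open>\<tau> > 0\<close>.\<close>
  proof (rule Limsup_at_infinity_pos[of "1 / C" "max (max R r0) (exp (exp 1))"])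
    fix x :: 'a assume x: "norm x > max (max R r0) (exp (exp 1))"
    define q where "q = norm x powr ((p - real N) / p) * ln (norm x) powr (2 / p)"
    have vx: "v x > 0" "v x \<le> C * q"
      using v[of x] C(2)[of "norm x"] x by (auto simp: \<beta>_def crit_neg q_def mult.assoc)
    have "exp 1 < ln (norm x)" using x ln_strict_mono[of "exp (exp 1)" "norm x"] by simp
    then have "1 < ln (ln (norm x))" using ln_strict_mono[of "exp 1" "ln (norm x)"] by simp
    then have "q * 1 \<le> q * ln (ln (norm x)) powr \<tau>"
      using \<tau> by (intro mult_left_mono ge_one_powr_ge_zero) (auto simp: q_def)
    then have "C * q \<le> C * (q * ln (ln (norm x)) powr \<tau>)" using C(1) by simp
    then have "v x \<le> C * (q * ln (ln (norm x)) powr \<tau>)" using vx by linarith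
    then show "1 / C \<le> norm x powr ((p - real N) / p)
          * ln (norm x) powr (2 / p) * ln (ln (norm x)) powr \<tau> / v x"
      using C(1) vx(1) unfolding q_def[symmetric] by (simp add: field_simps)
  qed (use C in simp)
qed

end
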